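(* Let $(X,\sigma)$ be a left non-degenerate braided set, and $A$ an abelian group. Then there is an isomorphism of abelian groups $$H^2(X,A)\simeq H^1\bigl(G_{(X,\sigma)},\operatorname{Fun}(X,A)\bigr),$$ where on the left $H^2$ is the (star version of the) cohomology of the braided set $(X,\sigma)$, and on the right is the group cohomology of the structure group $G_{(X,\sigma)}$ with coefficients in the right $G_{(X,\sigma)}$-module $\operatorname{Fun}(X,A)$.
   Context: A braided set is a set $X$ with a (not necessarily invertible) map $\sigma\colon X\times X\to X\times X$, $\sigma(a,b)=({}^{a}b,a^b)$, satisfying the Yang--Baxter equation $(\sigma\times\mathrm{Id})(\mathrm{Id}\times\sigma)(\sigma\times\mathrm{Id})=(\mathrm{Id}\times\sigma)(\sigma\times\mathrm{Id})(\mathrm{Id}\times\sigma)$. It is left non-degenerate if for every $b\in X$ the map $a\mapsto a^b$ is bijective; then $a\mapsto b\,\tilde{\cdot}\,a$ denotes its inverse, and $a\cdot b={}^{(b\,\tilde{\cdot}\,a)}b$. The structure group $G_{(X,\sigma)}$ is the group generated by $X$ with relations $ab={}^{a}b\,a^b$, $a,b\in X$; equivalently, with relations $(a\cdot b)\,a=(b\,\tilde{\cdot}\,a)\,b$. $\operatorname{Fun}(X,A)$ is the abelian group of maps $X\to A$; it is a right $G_{(X,\sigma)}$-module via the action determined on generators $a\in X$ by $(\gamma\cdot a)(b)=\gamma(a\,\tilde{\cdot}\,b)$. Star version of braided set cohomology in degree 2: $Z^2(X,A)$ is the group of maps $f\colon X\times X\to A$ with $f(x,z)+f(x\,\tilde{\cdot}\,y,\;x\,\tilde{\cdot}\,z)=f(y,z)+f(y\cdot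 x,\;y\,\tilde{\cdot}\,z)$ for all $x,y,z\in X$; $B^2(X,A)$ is the subgroup of maps $(x,y)\mapsto\gamma(x\,\tilde{\cdot}\,y)-\gamma(y)$ for $\gamma\in\operatorname{Fun}(X,A)$; $H^2(X,A)=Z^2(X,A)/B^2(X,A)$. Group cohomology $H^\ast(G,M)$ of a group $G$ with coefficients in a right $G$-module $M$ in degree 1: $1$-cocycles are maps $\theta\colon G\to M$ with $\theta(g_1g_2)=\theta(g_2)+\theta(g_1)g_2$; $1$-coboundaries are maps $g\mapsto m-mg$ with $m\in M$; $H^1(G,M)$ is the quotient. *)

theory Defs
  imports "HOL-Algebra.Product_Groups"
begin

section \<open>Braided sets\<close>

definition apply_left :: "('x \<times> 'x \<Rightarrow> 'x \<times> 'x) \<Rightarrow> 'x \<times> 'x \<times> 'x \<Rightarrow> 'x \<times> 'x \<times> 'x" where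
  "apply_left \<sigma> = (\<lambda>(a, b, c). (fst (\<sigma> (a, b)), snd (\<sigma> (a, b)), c))"

definition apply_right :: "('x \<times> 'x \<Rightarrow> 'x \<times> 'x) \<Rightarrow> 'x \<times> 'x \<times> 'x \<Rightarrow> 'x \<times> 'x \<times> 'x" where
  "apply_right \<sigma> = (\<lambda>(a, b, c). (a, \<sigma> (b, c)))"

locale braided_set =
  fixes X :: "'x set" and \<sigma> :: "'x \<times> 'x \<Rightarrow> 'x \<times> 'x"
  assumes braiding_closed: "\<sigma> \<in> X \<times> X \<rightarrow> X \<times> X"
    and yang_baxter: "t \<in> X \<times> X \<times> X \<Longrightarrow>
      apply_left \<sigma> (apply_right \<sigma> (apply_left \<sigma> t)) = apply_right \<sigma> (apply_left \<sigma> (apply_right \<sigma> t))"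

text \<open>We write \<open>\<sigma> (a, b) = (lact \<sigma> a b, ract \<sigma> a b)\<close>; on paper these are
  \<open>a\<close> acting on \<open>b\<close> from the left, and \<open>b\<close> acting on \<open>a\<close> from the right.\<close>

definition lact :: "('x \<times> 'x \<Rightarrow> 'x \<times> 'x) \<Rightarrow> 'x \<Rightarrow> 'x \<Rightarrow> 'x" where
  "lact \<sigma> a b = fst (\<sigma> (a, b))"

definition ract :: "('x \<times> 'x \<Rightarrow> 'x \<times> 'x) \<Rightarrow> 'x \<Rightarrow> 'x \<Rightarrow> 'x" where
  "ract \<sigma> a b = snd (\<sigma> (a, b))"

locale left_nondegenerate_braided_set = braided_set +
  assumes left_nondegenerate: "b \<in> X \<Longrightarrow> bij_betw (\<lambda>a. ract \<sigma> a b) X X"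

text \<open>\<open>tdot X \<sigma> b\<close> is the inverse of \<open>a \<mapsto> ract \<sigma> a b\<close> on \<open>X\<close>.\<close>

definition tdot :: "'x set \<Rightarrow> ('x \<times> 'x \<Rightarrow> 'x \<times> 'x) \<Rightarrow> 'x \<Rightarrow> 'x \<Rightarrow> 'x" where
  "tdot X \<sigma> b = inv_into X (\<lambda>a. ract \<sigma> a b)"

definition dot :: "'x set \<Rightarrow> ('x \<times> 'x \<Rightarrow> 'x \<times> 'x) \<Rightarrow> 'x \<Rightarrow> 'x \<Rightarrow> 'x" where
  "dot X \<sigma> a b = lact \<sigma> (tdot X \<sigma> b a) b"


section \<open>Groups given by generators and relations\<close>

text \<open>A signed word is a list of letters \<open>(x, e)\<close>, where \<open>(x, True)\<close> stands for the generator
  \<open>x\<close> and \<open>(x, False)\<close> for its inverse. The group generated by \<open>X\<close> subject to the relations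
  \<open>u = v\<close> for \<open>(u, v) \<in> R\<close> consists of the classes of signed words modulo the least congruence
  that contains \<open>R\<close> and cancels adjacent inverse letters.\<close>

type_synonym 'x sword = "('x \<times> bool) list"

definition swords :: "'x set \<Rightarrow> 'x sword set" where
  "swords X = lists (X \<times> UNIV)"

inductive_set word_cong :: "'x set \<Rightarrow> ('x sword \<times> 'x sword) set \<Rightarrow> ('x sword \<times> 'x sword) set"
  for X :: "'x set" and R :: "('x sword \<times> 'x sword) set" where
  rel: "\<lbrakk>(u, v) \<in> R; u \<in> swords X; v \<in> swords X\<rbrakk> \<Longrightarrow> (u, v) \<in> word_cong X R"
| cancel: "x \<in> X \<Longrightarrow> ([(x, e), (x, \<not> e)], []) \<in> word_cong X R"
| refl: "u \<in> swords X \<Longrightarrow> (u, u) \<in> word_cong X R"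
| sym: "(u, v) \<in> word_cong X R \<Longrightarrow> (v, u) \<in> word_cong X R"
| trans: "\<lbrakk>(u, v) \<in> word_cong X R; (v, w) \<in> word_cong X R\<rbrakk> \<Longrightarrow> (u, w) \<in> word_cong X R"
| append: "\<lbrakk>(u, u') \<in> word_cong X R; (v, v') \<in> word_cong X R\<rbrakk> \<Longrightarrow> (u @ v, u' @ v') \<in> word_cong X R"

definition word_class :: "'x set \<Rightarrow> ('x sword \<times> 'x sword) set \<Rightarrow> 'x sword \<Rightarrow> 'x sword set" where
  "word_class X R u = word_cong X R `` {u}"

definition presented_group :: "'x set \<Rightarrow> ('x sword \<times> 'x sword) set \<Rightarrow> 'x sword set monoid" where
  "presented_group X R =
    \<lparr>carrier = swords X // word_cong X R,
     mult = (\<lambda>C D. \<Union>u\<in>C. \<Union>v\<in>D. word_class X R (u @ v)),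
     one = word_class X R []\<rparr>"

lemma Nil_in_swords [simp]: "[] \<in> swords X"
  and Cons_in_swords [simp]: "p # u \<in> swords X \<longleftrightarrow> fst p \<in> X \<and> u \<in> swords X"
  and append_in_swords [simp]: "u @ v \<in> swords X \<longleftrightarrow> u \<in> swords X \<and> v \<in> swords X"
  by (cases p; auto simp: swords_def)+

lemma word_cong_in_swords: "(u, v) \<in> word_cong X R \<Longrightarrow> u \<in> swords X \<and> v \<in> swords X"
  by (induction rule: word_cong.induct) auto

lemma equiv_word_cong: "equiv (swords X) (word_cong X R)"
  by (rule equivI)
    (auto intro: refl_onI symI transI word_cong.refl dest: word_cong.sym word_cong.trans word_cong_in_swords)

lemma word_class_eq_iff:
  assumes "u \<in> swords X" "v \<in> swords X"
  shows "word_class X R u = word_class X R v \<longleftrightarrow> (u, v) \<in> word_cong X R"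
  unfolding word_class_def using eq_equiv_class_iff[OF equiv_word_cong assms] .

lemma carrier_presented_group: "carrier (presented_group X R) = word_class X R ` swords X"
  by (auto simp: presented_group_def word_class_def quotient_def)

lemma one_presented_group: "\<one>\<^bsub>presented_group X R\<^esub> = word_class X R []"
  by (simp add: presented_group_def)

lemma mult_presented_group:
  assumes "u \<in> swords X" "v \<in> swords X"
  shows "word_class X R u \<otimes>\<^bsub>presented_group X R\<^esub> word_class X R v = word_class X R (u @ v)"
proof -
  have "word_class X R (u' @ v') = word_class X R (u @ v)"
    if "u' \<in> word_class X R u" "v' \<in> word_class X R v" for u' v'
  proof -
    have "(u', u) \<in> word_cong X R" "(v', v) \<in> word_cong X R"
      using that by (auto simp: word_class_def intro: word_cong.sym)
    then show ?thesis
      using word_cong_in_swords by (subst word_class_eq_iff) (auto intro: word_cong.append dest: word_cong_in_swords)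
  qed
  then have "(\<Union>u'\<in>word_class X R u. \<Union>v'\<in>word_class X R v. word_class X R (u' @ v'))
      = (\<Union>u'\<in>word_class X R u. \<Union>v'\<in>word_class X R v. word_class X R (u @ v))"
    by (simp cong: SUP_cong)
  moreover have "u \<in> word_class X R u" "v \<in> word_class X R v"
    using assms by (auto simp: word_class_def intro: word_cong.refl)
  ultimately show ?thesis
    by (auto simp: presented_group_def)
qed

lemma word_cong_inverse:
  assumes "u \<in> swords X"
  shows "(rev (map (\<lambda>(x, e). (x, \<not> e)) u) @ u, []) \<in> word_cong X R"
  using assms
proof (induction u)
  case Nil
  then show ?case by (auto intro: word_cong.refl)
next
  case (Cons p u)
  obtain x e where p: "p = (x, e)" by force
  let ?v = "rev (map (\<lambda>(x, e). (x, \<not> e)) u)"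
  have *: "(?v @ u, []) \<in> word_cong X R" "x \<in> X" "u \<in> swords X"
    using Cons p by auto
  then have v: "?v \<in> swords X"
    using word_cong_in_swords by fastforce
  have "([(x, \<not> e), (x, e)], []) \<in> word_cong X R"
    using word_cong.cancel[of x X "\<not> e" R] * by simp
  then have "(?v @ [(x, \<not> e), (x, e)] @ u, ?v @ [] @ u) \<in> word_cong X R"
    using * v by (intro word_cong.append word_cong.refl)
  with * show ?case
    using p by (auto intro: word_cong.trans)
qed

lemma group_presented_group: "group (presented_group X R)"
proof (rule groupI)
  fix C assume "C \<in> carrier (presented_group X R)"
  then obtain u where u: "u \<in> swords X" "C = word_class X R u"
    by (auto simp: carrier_presented_group)
  let ?v = "rev (map (\<lambda>(x, e). (x, \<not> e)) u)"
  have v: "(?v @ u, []) \<in> word_cong X R"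
    using u by (intro word_cong_inverse)
  then have "?v \<in> swords X"
    using word_cong_in_swords by fastforce
  with u v show "\<exists>D\<in>carrier (presented_group X R).
      D \<otimes>\<^bsub>presented_group X R\<^esub> C = \<one>\<^bsub>presented_group X R\<^esub>"
    by (intro bexI[of _ "word_class X R ?v"])
      (auto simp: mult_presented_group one_presented_group carrier_presented_group word_class_eq_iff)
qed (auto simp: carrier_presented_group mult_presented_group one_presented_group)


section \<open>The structure group and its action on functions\<close>

definition structure_relations ::
  "'x set \<Rightarrow> ('x \<times> 'x \<Rightarrow> 'x \<times> 'x) \<Rightarrow> ('x sword \<times> 'x sword) set" where
  "structure_relations X \<sigma> =
    {([(a, True), (b, True)], [(lact \<sigma> a b, True), (ract \<sigma> a b, True)]) | a b. a \<in> X \<and> b \<in> X}"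

definition structure_group :: "'x set \<Rightarrow> ('x \<times> 'x \<Rightarrow> 'x \<times> 'x) \<Rightarrow> 'x sword set monoid" where
  "structure_group X \<sigma> = presented_group X (structure_relations X \<sigma>)"

definition structure_gen :: "'x set \<Rightarrow> ('x \<times> 'x \<Rightarrow> 'x \<times> 'x) \<Rightarrow> 'x \<Rightarrow> 'x sword set" where
  "structure_gen X \<sigma> a = word_class X (structure_relations X \<sigma>) [(a, True)]"

text \<open>The abelian group \<open>A\<close> is written multiplicatively throughout, as a \<^const>\<open>comm_group\<close>.\<close>

abbreviation Fun_group :: "'x set \<Rightarrow> ('a, 'm) monoid_scheme \<Rightarrow> ('x \<Rightarrow> 'a) monoid" where
  "Fun_group X A \<equiv> product_group X (\<lambda>_. A)"

text \<open>A generator \<open>a\<close> acts by precomposition with \<open>b \<mapsto> tdot X \<sigma> a b\<close>, so its formal inverse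
  must act by precomposition with the inverse map \<open>b \<mapsto> ract \<sigma> b a\<close>. A word acts on the right,
  hence its first letter acts first.\<close>

fun word_act :: "'x set \<Rightarrow> ('x \<times> 'x \<Rightarrow> 'x \<times> 'x) \<Rightarrow> ('x \<Rightarrow> 'a) \<Rightarrow> 'x sword \<Rightarrow> 'x \<Rightarrow> 'a" where
  "word_act X \<sigma> \<gamma> [] = \<gamma>"
| "word_act X \<sigma> \<gamma> ((a, True) # u) = word_act X \<sigma> (\<lambda>b\<in>X. \<gamma> (tdot X \<sigma> a b)) u"
| "word_act X \<sigma> \<gamma> ((a, False) # u) = word_act X \<sigma> (\<lambda>b\<in>X. \<gamma> (ract \<sigma> b a)) u"

text \<open>All representatives of an element of the structure group act in the same way; see
  \<open>Fun_right_module\<close> and \<open>Fun_act_gen\<close> below.\<close>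

definition Fun_act ::
  "'x set \<Rightarrow> ('x \<times> 'x \<Rightarrow> 'x \<times> 'x) \<Rightarrow> ('x \<Rightarrow> 'a) \<Rightarrow> 'x sword set \<Rightarrow> 'x \<Rightarrow> 'a" where
  "Fun_act X \<sigma> \<gamma> C = the_elem (word_act X \<sigma> \<gamma> ` C)"


section \<open>Group cohomology in degree 1\<close>

locale right_group_module = G: group G + M: comm_group M
  for G :: "('g, 'm) monoid_scheme" (structure) and M :: "('v, 'n) monoid_scheme" (structure)
    and act :: "'v \<Rightarrow> 'g \<Rightarrow> 'v" +
  assumes act_closed: "\<lbrakk>m \<in> carrier M; g \<in> carrier G\<rbrakk> \<Longrightarrow> act m g \<in> carrier M"
    and act_add: "\<lbrakk>m \<in> carrier M; m' \<in> carrier M; g \<in> carrier G\<rbrakk> \<Longrightarrow>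
      act (m \<otimes>\<^bsub>M\<^esub> m') g = act m g \<otimes>\<^bsub>M\<^esub> act m' g"
    and act_one: "m \<in> carrier M \<Longrightarrow> act m \<one>\<^bsub>G\<^esub> = m"
    and act_mult: "\<lbrakk>m \<in> carrier M; g \<in> carrier G; h \<in> carrier G\<rbrakk> \<Longrightarrow>
      act m (g \<otimes>\<^bsub>G\<^esub> h) = act (act m g) h"

text \<open>Cocycles and coboundaries are extensional maps, i.e. elements of a direct power of the
  coefficient group.\<close>

definition group_Z1 ::
  "('g, 'm) monoid_scheme \<Rightarrow> ('v, 'n) monoid_scheme \<Rightarrow> ('v \<Rightarrow> 'g \<Rightarrow> 'v) \<Rightarrow> ('g \<Rightarrow> 'v) set" where
  "group_Z1 G M act = {\<theta> \<in> carrier G \<rightarrow>\<^sub>E carrier M.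
    \<forall>g\<in>carrier G. \<forall>h\<in>carrier G. \<theta> (g \<otimes>\<^bsub>G\<^esub> h) = \<theta> h \<otimes>\<^bsub>M\<^esub> act (\<theta> g) h}"

definition group_B1 ::
  "('g, 'm) monoid_scheme \<Rightarrow> ('v, 'n) monoid_scheme \<Rightarrow> ('v \<Rightarrow> 'g \<Rightarrow> 'v) \<Rightarrow> ('g \<Rightarrow> 'v) set" where
  "group_B1 G M act = {\<lambda>g\<in>carrier G. m \<otimes>\<^bsub>M\<^esub> inv\<^bsub>M\<^esub> act m g | m. m \<in> carrier M}"

definition group_H1 ::
  "('g, 'm) monoid_scheme \<Rightarrow> ('v, 'n) monoid_scheme \<Rightarrow> ('v \<Rightarrow> 'g \<Rightarrow> 'v) \<Rightarrow> ('g \<Rightarrow> 'v) set monoid" where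
  "group_H1 G M act =
    (product_group (carrier G) (\<lambda>_. M))\<lparr>carrier := group_Z1 G M act\<rparr> Mod group_B1 G M act"


section \<open>Braided cohomology in degree 2, star version\<close>

definition braided_Z2 ::
  "'x set \<Rightarrow> ('x \<times> 'x \<Rightarrow> 'x \<times> 'x) \<Rightarrow> ('a, 'm) monoid_scheme \<Rightarrow> ('x \<times> 'x \<Rightarrow> 'a) set" where
  "braided_Z2 X \<sigma> A = {f \<in> X \<times> X \<rightarrow>\<^sub>E carrier A.
    \<forall>x\<in>X. \<forall>y\<in>X. \<forall>z\<in>X.
      f (x, z) \<otimes>\<^bsub>A\<^esub> f (tdot X \<sigma> x y, tdot X \<sigma> x z) =
      f (y, z) \<otimes>\<^bsub>A\<^esub> f (dot X \<sigma> y x, tdot X \<sigma> y z)}"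

definition braided_B2 ::
  "'x set \<Rightarrow> ('x \<times> 'x \<Rightarrow> 'x \<times> 'x) \<Rightarrow> ('a, 'm) monoid_scheme \<Rightarrow> ('x \<times> 'x \<Rightarrow> 'a) set" where
  "braided_B2 X \<sigma> A =
    {\<lambda>(x, y)\<in>X \<times> X. \<gamma> (tdot X \<sigma> x y) \<otimes>\<^bsub>A\<^esub> inv\<^bsub>A\<^esub> \<gamma> y | \<gamma>. \<gamma> \<in> carrier (Fun_group X A)}"

definition braided_H2 ::
  "'x set \<Rightarrow> ('x \<times> 'x \<Rightarrow> 'x \<times> 'x) \<Rightarrow> ('a, 'm) monoid_scheme \<Rightarrow> ('x \<times> 'x \<Rightarrow> 'a) set monoid" where
  "braided_H2 X \<sigma> A = (product_group (X \<times> X) (\<lambda>_. A))\<lparr>carrier := braided_Z2 X \<sigma> A\<rparr> Mod braided_B2 X \<sigma> A"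


section \<open>The objects above are what they should be\<close>

lemma comm_group_product_group:
  assumes "\<And>i. i \<in> I \<Longrightarrow> comm_group (G i)"
  shows "comm_group (product_group I G)"
proof (rule group.group_comm_groupI)
  show "group (product_group I G)"
    using assms by (simp add: comm_group.axioms(2))
  show "x \<otimes>\<^bsub>product_group I G\<^esub> y = y \<otimes>\<^bsub>product_group I G\<^esub> x"
    if "x \<in> carrier (product_group I G)" "y \<in> carrier (product_group I G)" for x y
    using that assms
    by (auto simp: PiE_iff comm_groupE(4) intro!: restrict_ext)
qed

lemma comm_group_subquotient:
  assumes "comm_group C" "subgroup Z C" "subgroup B C" "B \<subseteq> Z"
  shows "comm_group (C\<lparr>carrier := Z\<rparr> Mod B)"
proof -
  interpret C: comm_group C by fact
  have "comm_group (C\<lparr>carrier := Z\<rparr>)"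
    using assms C.subgroup_imp_group[of Z]
    by (intro group.group_comm_groupI) (auto dest: subgroup.mem_carrier intro: C.m_comm)
  moreover have "subgroup B (C\<lparr>carrier := Z\<rparr>)"
    using assms C.subgroup_incl by blast
  ultimately show ?thesis
    by (rule comm_group.abelian_FactGroup)
qed

context right_group_module
begin

lemma act_neutral: "g \<in> carrier G \<Longrightarrow> act \<one>\<^bsub>M\<^esub> g = \<one>\<^bsub>M\<^esub>"
  by (metis M.l_cancel_one M.one_closed M.r_one act_add act_closed)

lemma act_inv:
  assumes "m \<in> carrier M" "g \<in> carrier G"
  shows "act (inv\<^bsub>M\<^esub> m) g = inv\<^bsub>M\<^esub> act m g"
  using assms act_add[of "inv\<^bsub>M\<^esub> m" m g]
  by (intro M.inv_equality[symmetric]) (simp_all add: act_closed act_neutral)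

lemma comm_group_cochains: "comm_group (product_group (carrier G) (\<lambda>_. M))"
  by (intro comm_group_product_group M.comm_group_axioms)

lemma subgroup_Z1: "subgroup (group_Z1 G M act) (product_group (carrier G) (\<lambda>_. M))"
proof (rule group.subgroupI)
  show "group (product_group (carrier G) (\<lambda>_. M))"
    by (intro comm_group.axioms(2) comm_group_cochains)
  have "(\<lambda>g\<in>carrier G. \<one>\<^bsub>M\<^esub>) \<in> group_Z1 G M act"
    by (auto simp: group_Z1_def act_neutral)
  then show "group_Z1 G M act \<noteq> {}"
    by blast
  show "\<theta> \<otimes>\<^bsub>product_group (carrier G) (\<lambda>_. M)\<^esub> \<eta> \<in> group_Z1 G M act"
    if "\<theta> \<in> group_Z1 G M act" "\<eta> \<in> group_Z1 G M act" for \<theta> \<eta>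
    using that by (auto simp: group_Z1_def PiE_iff act_add act_closed M.m_ac)
  show "inv\<^bsub>product_group (carrier G) (\<lambda>_. M)\<^esub> \<theta> \<in> group_Z1 G M act"
    if "\<theta> \<in> group_Z1 G M act" for \<theta>
    using that
    by (subst inv_product_group)
      (auto simp: group_Z1_def PiE_iff act_inv act_closed M.inv_mult)
qed (auto simp: group_Z1_def)

lemma subgroup_B1: "subgroup (group_B1 G M act) (product_group (carrier G) (\<lambda>_. M))"
proof (rule group.subgroupI)
  show "group (product_group (carrier G) (\<lambda>_. M))"
    by (intro comm_group.axioms(2) comm_group_cochains)
  show "group_B1 G M act \<noteq> {}"
    unfolding group_B1_def by blast
  show sub: "group_B1 G M act \<subseteq> carrier (product_group (carrier G) (\<lambda>_. M))"
    by (auto simp: group_B1_def act_closed)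
  show "\<theta> \<otimes>\<^bsub>product_group (carrier G) (\<lambda>_. M)\<^esub> \<eta> \<in> group_B1 G M act"
    if \<theta>\<eta>: "\<theta> \<in> group_B1 G M act" "\<eta> \<in> group_B1 G M act" for \<theta> \<eta>
  proof -
    obtain m n where mn: "m \<in> carrier M" "n \<in> carrier M"
      "\<theta> = (\<lambda>g\<in>carrier G. m \<otimes>\<^bsub>M\<^esub> inv\<^bsub>M\<^esub> act m g)" "\<eta> = (\<lambda>g\<in>carrier G. n \<otimes>\<^bsub>M\<^esub> inv\<^bsub>M\<^esub> act n g)"
      using \<theta>\<eta> by (auto simp: group_B1_def)
    then have "\<theta> \<otimes>\<^bsub>product_group (carrier G) (\<lambda>_. M)\<^esub> \<eta>
        = (\<lambda>g\<in>carrier G. (m \<otimes>\<^bsub>M\<^esub> n) \<otimes>\<^bsub>M\<^esub> inv\<^bsub>M\<^esub> act (m \<otimes>\<^bsub>M\<^esub> n) g)"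
      by (auto simp: act_add act_closed M.inv_mult M.m_ac intro!: restrict_ext)
    with mn show ?thesis
      unfolding group_B1_def by blast
  qed
  show "inv\<^bsub>product_group (carrier G) (\<lambda>_. M)\<^esub> \<theta> \<in> group_B1 G M act"
    if \<theta>: "\<theta> \<in> group_B1 G M act" for \<theta>
  proof -
    obtain m where m: "m \<in> carrier M" "\<theta> = (\<lambda>g\<in>carrier G. m \<otimes>\<^bsub>M\<^esub> inv\<^bsub>M\<^esub> act m g)"
      using \<theta> by (auto simp: group_B1_def)
    have "\<theta> \<in> (\<Pi>\<^sub>E g\<in>carrier G. carrier M)"
      using sub \<theta> by auto
    then have "inv\<^bsub>product_group (carrier G) (\<lambda>_. M)\<^esub> \<theta>
        = (\<lambda>g\<in>carrier G. inv\<^bsub>M\<^esub> m \<otimes>\<^bsub>M\<^esub> inv\<^bsub>M\<^esub> act (inv\<^bsub>M\<^esub> m) g)"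
      using m by (auto simp: act_inv act_closed M.inv_mult intro!: restrict_ext)
    with m show ?thesis
      unfolding group_B1_def by blast
  qed
qed

lemma B1_subset_Z1: "group_B1 G M act \<subseteq> group_Z1 G M act"
proof
  fix \<theta> assume "\<theta> \<in> group_B1 G M act"
  then obtain m where m: "m \<in> carrier M" "\<theta> = (\<lambda>g\<in>carrier G. m \<otimes>\<^bsub>M\<^esub> inv\<^bsub>M\<^esub> act m g)"
    by (auto simp: group_B1_def)
  have "m \<otimes>\<^bsub>M\<^esub> inv\<^bsub>M\<^esub> act (act m g) h =
      (m \<otimes>\<^bsub>M\<^esub> inv\<^bsub>M\<^esub> act m h) \<otimes>\<^bsub>M\<^esub> (act m h \<otimes>\<^bsub>M\<^esub> inv\<^bsub>M\<^esub> act (act m g) h)"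
    if "g \<in> carrier G" "h \<in> carrier G" for g h
    using that m by (metis M.inv_closed M.inv_solve_right M.m_assoc M.m_closed act_closed)
  with m show "\<theta> \<in> group_Z1 G M act"
    by (auto simp: group_Z1_def act_closed act_add act_inv act_mult)
qed

lemma comm_group_H1: "comm_group (group_H1 G M act)"
  unfolding group_H1_def
  by (intro comm_group_subquotient comm_group_cochains subgroup_Z1 subgroup_B1 B1_subset_Z1)

end

context left_nondegenerate_braided_set
begin

lemma lact_closed: "\<lbrakk>a \<in> X; b \<in> X\<rbrakk> \<Longrightarrow> lact \<sigma> a b \<in> X"
  and ract_closed: "\<lbrakk>a \<in> X; b \<in> X\<rbrakk> \<Longrightarrow> ract \<sigma> a b \<in> X"
  using braiding_closed by (force simp: lact_def ract_def Pi_iff mem_Times_iff)+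

lemma tdot_closed: "\<lbrakk>a \<in> X; b \<in> X\<rbrakk> \<Longrightarrow> tdot X \<sigma> a b \<in> X"
  and ract_tdot: "\<lbrakk>a \<in> X; b \<in> X\<rbrakk> \<Longrightarrow> ract \<sigma> (tdot X \<sigma> a b) a = b"
  and tdot_ract: "\<lbrakk>a \<in> X; b \<in> X\<rbrakk> \<Longrightarrow> tdot X \<sigma> a (ract \<sigma> b a) = b"
  using left_nondegenerate[of a]
  by (auto simp: tdot_def bij_betw_def inv_into_into
      intro!: f_inv_into_f[of b "\<lambda>x. ract \<sigma> x a"] inv_into_f_f[of "\<lambda>x. ract \<sigma> x a" X b])

lemma dot_closed: "\<lbrakk>a \<in> X; b \<in> X\<rbrakk> \<Longrightarrow> dot X \<sigma> a b \<in> X"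
  by (simp add: dot_def lact_closed tdot_closed)

lemma ract_ract:
  assumes "a \<in> X" "b \<in> X" "c \<in> X"
  shows "ract \<sigma> (ract \<sigma> a b) c = ract \<sigma> (ract \<sigma> a (lact \<sigma> b c)) (ract \<sigma> b c)"
  using yang_baxter[of "(a, b, c)"] assms
  by (simp add: apply_left_def apply_right_def lact_def ract_def split_beta) (metis snd_conv)

lemma tdot_tdot:
  assumes "a \<in> X" "b \<in> X" "c \<in> X"
  shows "tdot X \<sigma> a (tdot X \<sigma> b c) = tdot X \<sigma> (lact \<sigma> a b) (tdot X \<sigma> (ract \<sigma> a b) c)"
proof -
  let ?d = "tdot X \<sigma> (lact \<sigma> a b) (tdot X \<sigma> (ract \<sigma> a b) c)"
  have "?d \<in> X"
    using assms by (simp add: tdot_closed lact_closed ract_closed)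
  moreover from this have "ract \<sigma> (ract \<sigma> ?d a) b = c"
    using assms by (subst ract_ract) (simp_all add: ract_tdot tdot_closed lact_closed ract_closed)
  ultimately show ?thesis
    using assms by (metis ract_closed tdot_ract)
qed

lemma word_act_append: "word_act X \<sigma> \<gamma> (u @ v) = word_act X \<sigma> (word_act X \<sigma> \<gamma> u) v"
  by (induction X \<sigma> \<gamma> u rule: word_act.induct) (simp_all cong: restrict_cong del: restrict_apply)

lemma word_act_closed:
  assumes "\<gamma> \<in> X \<rightarrow>\<^sub>E carrier A" "u \<in> swords X"
  shows "word_act X \<sigma> \<gamma> u \<in> X \<rightarrow>\<^sub>E carrier A"
  using assms
proof (induction u arbitrary: \<gamma>)
  case (Cons p u)
  obtain a e where p: "p = (a, e)" by force
  have "(\<lambda>b\<in>X. \<gamma> (tdot X \<sigma> a b)) \<in> X \<rightarrow>\<^sub>E carrier A" "(\<lambda>b\<in>X. \<gamma> (ract \<sigma> b a)) \<in> X \<rightarrow>\<^sub>E carrier A"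
    using Cons.prems p by (auto intro!: tdot_closed ract_closed)
  from this[THEN Cons.IH] show ?case
    using Cons.prems p by (cases e) (simp_all del: restrict_apply)
qed auto

lemma word_act_cong:
  assumes "(u, v) \<in> word_cong X (structure_relations X \<sigma>)" "\<gamma> \<in> X \<rightarrow>\<^sub>E carrier A"
  shows "word_act X \<sigma> \<gamma> u = word_act X \<sigma> \<gamma> v"
  using assms
proof (induction arbitrary: \<gamma> rule: word_cong.induct)
  case (rel u v)
  then show ?case
    by (auto simp: structure_relations_def lact_closed ract_closed tdot_closed
        simp flip: tdot_tdot intro!: restrict_ext)
next
  case (cancel a e)
  then show ?case
    by (cases e) (auto simp: fun_eq_iff PiE_iff extensional_def tdot_closed ract_closed ract_tdot tdot_ract)
next
  case (append u u' v v')
  then show ?case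
    by (metis word_act_append word_act_closed word_cong_in_swords)
qed auto

lemma Fun_act_word_class:
  assumes "\<gamma> \<in> X \<rightarrow>\<^sub>E carrier A" "u \<in> swords X"
  shows "Fun_act X \<sigma> \<gamma> (word_class X (structure_relations X \<sigma>) u) = word_act X \<sigma> \<gamma> u"
proof -
  have "u \<in> word_class X (structure_relations X \<sigma>) u"
    using assms by (simp add: word_class_def word_cong.refl)
  moreover have "word_act X \<sigma> \<gamma> v = word_act X \<sigma> \<gamma> u"
    if "v \<in> word_class X (structure_relations X \<sigma>) u" for v
    using that word_act_cong[OF _ assms(1), of u v] by (simp add: word_class_def)
  ultimately have "word_act X \<sigma> \<gamma> ` word_class X (structure_relations X \<sigma>) u = {word_act X \<sigma> \<gamma> u}"
    by blast
  then show ?thesis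
    by (simp add: Fun_act_def)
qed

lemma Fun_act_gen:
  assumes "\<gamma> \<in> carrier (Fun_group X A)" "a \<in> X" "b \<in> X"
  shows "Fun_act X \<sigma> \<gamma> (structure_gen X \<sigma> a) b = \<gamma> (tdot X \<sigma> a b)"
  using assms by (simp add: structure_gen_def Fun_act_word_class)

lemma word_act_mult:
  assumes "group A" "\<gamma> \<in> X \<rightarrow>\<^sub>E carrier A" "\<delta> \<in> X \<rightarrow>\<^sub>E carrier A" "u \<in> swords X"
  shows "word_act X \<sigma> (\<lambda>b\<in>X. \<gamma> b \<otimes>\<^bsub>A\<^esub> \<delta> b) u = (\<lambda>b\<in>X. word_act X \<sigma> \<gamma> u b \<otimes>\<^bsub>A\<^esub> word_act X \<sigma> \<delta> u b)"
  using assms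
proof (induction u arbitrary: \<gamma> \<delta>)
  case (Cons p u)
  obtain a e where p: "p = (a, e)" by force
  define g where "g b = (if e then tdot X \<sigma> a b else ract \<sigma> b a)" for b
  have g: "g b \<in> X" if "b \<in> X" for b
    using that Cons.prems p by (simp add: g_def tdot_closed ract_closed)
  have act: "word_act X \<sigma> \<eta> (p # u) = word_act X \<sigma> (\<lambda>b\<in>X. \<eta> (g b)) u" for \<eta> :: "'a \<Rightarrow> 'b"
    by (cases e) (simp_all add: p g_def)
  have eq: "(\<lambda>b\<in>X. (\<lambda>b\<in>X. \<gamma> b \<otimes>\<^bsub>A\<^esub> \<delta> b) (g b))
      = (\<lambda>b\<in>X. (\<lambda>b\<in>X. \<gamma> (g b)) b \<otimes>\<^bsub>A\<^esub> (\<lambda>b\<in>X. \<delta> (g b)) b)"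
    using g by (auto intro!: restrict_ext)
  have gd: "(\<lambda>b\<in>X. \<gamma> (g b)) \<in> X \<rightarrow>\<^sub>E carrier A" "(\<lambda>b\<in>X. \<delta> (g b)) \<in> X \<rightarrow>\<^sub>E carrier A"
    using Cons.prems g by auto
  have u: "u \<in> swords X"
    using Cons.prems by simp
  show ?case
    by (simp only: act eq Cons.IH[OF Cons.prems(1) gd u])
qed auto

lemma Fun_right_module:
  assumes "comm_group A"
  shows "right_group_module (structure_group X \<sigma>) (Fun_group X A) (Fun_act X \<sigma>)"
proof -
  interpret A: comm_group A by fact
  show ?thesis
  proof (intro right_group_module.intro right_group_module_axioms.intro)
    show "group (structure_group X \<sigma>)"
      by (simp add: structure_group_def group_presented_group)
    show "comm_group (Fun_group X A)"
      using assms by (rule comm_group_product_group)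
  next
    fix \<gamma> g assume "\<gamma> \<in> carrier (Fun_group X A)" "g \<in> carrier (structure_group X \<sigma>)"
    then show "Fun_act X \<sigma> \<gamma> g \<in> carrier (Fun_group X A)"
      by (clarsimp simp: structure_group_def carrier_presented_group Fun_act_word_class word_act_closed)
  next
    fix \<gamma> \<delta> g assume "\<gamma> \<in> carrier (Fun_group X A)" "\<delta> \<in> carrier (Fun_group X A)"
      and g: "g \<in> carrier (structure_group X \<sigma>)"
    then have gd: "\<gamma> \<in> X \<rightarrow>\<^sub>E carrier A" "\<delta> \<in> X \<rightarrow>\<^sub>E carrier A"
      by auto
    obtain u where u: "u \<in> swords X" "g = word_class X (structure_relations X \<sigma>) u"
      using g by (auto simp: structure_group_def carrier_presented_group)
    have "(\<lambda>b\<in>X. \<gamma> b \<otimes>\<^bsub>A\<^esub> \<delta> b) \<in> X \<rightarrow>\<^sub>E carrier A"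
      using gd by auto
    with gd u show "Fun_act X \<sigma> (\<gamma> \<otimes>\<^bsub>Fun_group X A\<^esub> \<delta>) g
        = Fun_act X \<sigma> \<gamma> g \<otimes>\<^bsub>Fun_group X A\<^esub> Fun_act X \<sigma> \<delta> g"
      by (simp add: Fun_act_word_class word_act_mult A.group_axioms)
  next
    fix \<gamma> assume "\<gamma> \<in> carrier (Fun_group X A)"
    then show "Fun_act X \<sigma> \<gamma> \<one>\<^bsub>structure_group X \<sigma>\<^esub> = \<gamma>"
      by (simp add: structure_group_def one_presented_group Fun_act_word_class)
  next
    fix \<gamma> g h assume "\<gamma> \<in> carrier (Fun_group X A)"
      "g \<in> carrier (structure_group X \<sigma>)" "h \<in> carrier (structure_group X \<sigma>)"
    then show "Fun_act X \<sigma> \<gamma> (g \<otimes>\<^bsub>structure_group X \<sigma>\<^esub> h) = Fun_act X \<sigma> (Fun_act X \<sigma> \<gamma> g) h"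
      by (auto simp: structure_group_def carrier_presented_group mult_presented_group
          Fun_act_word_class[where A = A] word_act_append word_act_closed)
  qed
qed

lemma dot_tdot_tdot:
  assumes "x \<in> X" "y \<in> X" "z \<in> X"
  shows "tdot X \<sigma> (dot X \<sigma> y x) (tdot X \<sigma> y z) = tdot X \<sigma> (tdot X \<sigma> x y) (tdot X \<sigma> x z)"
  using tdot_tdot[of "tdot X \<sigma> x y" x z] assms by (simp add: dot_def tdot_closed ract_tdot)

lemma comm_group_H2:
  assumes "comm_group A"
  shows "comm_group (braided_H2 X \<sigma> A)"
proof -
  interpret A: comm_group A by fact
  let ?C = "product_group (X \<times> X) (\<lambda>_. A)"
  have C: "comm_group ?C"
    by (intro comm_group_product_group assms)
  then have gC: "group ?C"
    by (rule comm_group.axioms(2))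
  note closed = tdot_closed dot_closed
  have Z: "subgroup (braided_Z2 X \<sigma> A) ?C"
  proof (rule group.subgroupI[OF gC])
    have "(\<lambda>p\<in>X \<times> X. \<one>\<^bsub>A\<^esub>) \<in> braided_Z2 X \<sigma> A"
      by (auto simp: braided_Z2_def closed)
    then show "braided_Z2 X \<sigma> A \<noteq> {}"
      by blast
    show "f \<otimes>\<^bsub>?C\<^esub> g \<in> braided_Z2 X \<sigma> A"
      if fg: "f \<in> braided_Z2 X \<sigma> A" "g \<in> braided_Z2 X \<sigma> A" for f g
    proof -
      have val: "f (x, y) \<in> carrier A" "g (x, y) \<in> carrier A" if "x \<in> X" "y \<in> X" for x y
        using that fg by (auto simp: braided_Z2_def)
      have swap: "(a \<otimes>\<^bsub>A\<^esub> b) \<otimes>\<^bsub>A\<^esub> (c \<otimes>\<^bsub>A\<^esub> d) = (a \<otimes>\<^bsub>A\<^esub> c) \<otimes>\<^bsub>A\<^esub> (b \<otimes>\<^bsub>A\<^esub> d)"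
        if "a \<in> carrier A" "b \<in> carrier A" "c \<in> carrier A" "d \<in> carrier A" for a b c d
        using that by (simp add: A.m_ac)
      have "(f (x, z) \<otimes>\<^bsub>A\<^esub> g (x, z)) \<otimes>\<^bsub>A\<^esub>
          (f (tdot X \<sigma> x y, tdot X \<sigma> x z) \<otimes>\<^bsub>A\<^esub> g (tdot X \<sigma> x y, tdot X \<sigma> x z)) =
          (f (y, z) \<otimes>\<^bsub>A\<^esub> g (y, z)) \<otimes>\<^bsub>A\<^esub>
          (f (dot X \<sigma> y x, tdot X \<sigma> y z) \<otimes>\<^bsub>A\<^esub> g (dot X \<sigma> y x, tdot X \<sigma> y z))"
        if xyz: "x \<in> X" "y \<in> X" "z \<in> X" for x y z
      proof -
        have "f (x, z) \<otimes>\<^bsub>A\<^esub> f (tdot X \<sigma> x y, tdot X \<sigma> x z) =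
            f (y, z) \<otimes>\<^bsub>A\<^esub> f (dot X \<sigma> y x, tdot X \<sigma> y z)"
          "g (x, z) \<otimes>\<^bsub>A\<^esub> g (tdot X \<sigma> x y, tdot X \<sigma> x z) =
            g (y, z) \<otimes>\<^bsub>A\<^esub> g (dot X \<sigma> y x, tdot X \<sigma> y z)"
          using xyz fg by (simp_all add: braided_Z2_def)
        then show ?thesis
          using xyz by (subst swap, simp_all add: val closed, subst swap, simp_all add: val closed)
      qed
      then show ?thesis
        using val by (auto simp: braided_Z2_def closed)
    qed
    show "inv\<^bsub>?C\<^esub> f \<in> braided_Z2 X \<sigma> A" if f: "f \<in> braided_Z2 X \<sigma> A" for f
    proof -
      have fC: "f \<in> (\<Pi>\<^sub>E p\<in>X \<times> X. carrier A)"
        using f by (auto simp: braided_Z2_def)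
      have val: "f (x, y) \<in> carrier A" if "x \<in> X" "y \<in> X" for x y
        using that fC by auto
      have "inv\<^bsub>A\<^esub> f (x, z) \<otimes>\<^bsub>A\<^esub> inv\<^bsub>A\<^esub> f (tdot X \<sigma> x y, tdot X \<sigma> x z) =
          inv\<^bsub>A\<^esub> f (y, z) \<otimes>\<^bsub>A\<^esub> inv\<^bsub>A\<^esub> f (dot X \<sigma> y x, tdot X \<sigma> y z)"
        if xyz: "x \<in> X" "y \<in> X" "z \<in> X" for x y z
        using xyz f by (simp add: braided_Z2_def val closed flip: A.inv_mult)
      moreover have "inv\<^bsub>?C\<^esub> f = (\<lambda>p\<in>X \<times> X. inv\<^bsub>A\<^esub> f p)"
        using fC by (intro inv_product_group) auto
      ultimately show ?thesis
        using val by (auto simp: braided_Z2_def closed)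
    qed
  qed (auto simp: braided_Z2_def)
  have subC: "braided_B2 X \<sigma> A \<subseteq> carrier ?C"
    by (auto simp: braided_B2_def closed PiE_iff split: if_splits)
  have B: "subgroup (braided_B2 X \<sigma> A) ?C"
  proof (rule group.subgroupI[OF gC subC])
    have "(\<lambda>x\<in>X. \<one>\<^bsub>A\<^esub>) \<in> carrier (Fun_group X A)"
      by auto
    then show "braided_B2 X \<sigma> A \<noteq> {}"
      unfolding braided_B2_def by blast
    show "f \<otimes>\<^bsub>?C\<^esub> g \<in> braided_B2 X \<sigma> A"
      if fg: "f \<in> braided_B2 X \<sigma> A" "g \<in> braided_B2 X \<sigma> A" for f g
    proof -
      obtain \<gamma> \<delta> where gd: "\<gamma> \<in> carrier (Fun_group X A)" "\<delta> \<in> carrier (Fun_group X A)"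
        "f = (\<lambda>(x, y)\<in>X \<times> X. \<gamma> (tdot X \<sigma> x y) \<otimes>\<^bsub>A\<^esub> inv\<^bsub>A\<^esub> \<gamma> y)"
        "g = (\<lambda>(x, y)\<in>X \<times> X. \<delta> (tdot X \<sigma> x y) \<otimes>\<^bsub>A\<^esub> inv\<^bsub>A\<^esub> \<delta> y)"
        using fg unfolding braided_B2_def by blast
      define \<epsilon> where "\<epsilon> = (\<lambda>x\<in>X. \<gamma> x \<otimes>\<^bsub>A\<^esub> \<delta> x)"
      have "\<epsilon> \<in> carrier (Fun_group X A)"
        using gd by (auto simp: \<epsilon>_def)
      moreover have val: "\<gamma> x \<in> carrier A" "\<delta> x \<in> carrier A" if "x \<in> X" for x
        using gd that by auto
      then have "f \<otimes>\<^bsub>?C\<^esub> g = (\<lambda>(x, y)\<in>X \<times> X. \<epsilon> (tdot X \<sigma> x y) \<otimes>\<^bsub>A\<^esub> inv\<^bsub>A\<^esub> \<epsilon> y)"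
        by (auto simp: gd(3,4) \<epsilon>_def closed A.inv_mult A.m_ac intro!: restrict_ext)
      ultimately show ?thesis
        unfolding braided_B2_def by blast
    qed
    show "inv\<^bsub>?C\<^esub> f \<in> braided_B2 X \<sigma> A" if f: "f \<in> braided_B2 X \<sigma> A" for f
    proof -
      obtain \<gamma> where g: "\<gamma> \<in> carrier (Fun_group X A)"
        "f = (\<lambda>(x, y)\<in>X \<times> X. \<gamma> (tdot X \<sigma> x y) \<otimes>\<^bsub>A\<^esub> inv\<^bsub>A\<^esub> \<gamma> y)"
        using f unfolding braided_B2_def by blast
      define \<epsilon> where "\<epsilon> = (\<lambda>x\<in>X. inv\<^bsub>A\<^esub> \<gamma> x)"
      have "\<epsilon> \<in> carrier (Fun_group X A)"
        using g by (auto simp: \<epsilon>_def)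
      moreover have val: "\<gamma> x \<in> carrier A" if "x \<in> X" for x
        using g that by auto
      moreover have "inv\<^bsub>?C\<^esub> f = (\<lambda>p\<in>X \<times> X. inv\<^bsub>A\<^esub> f p)"
        using f subC by (intro inv_product_group) auto
      then have "inv\<^bsub>?C\<^esub> f = (\<lambda>(x, y)\<in>X \<times> X. \<epsilon> (tdot X \<sigma> x y) \<otimes>\<^bsub>A\<^esub> inv\<^bsub>A\<^esub> \<epsilon> y)"
        using val by (auto simp: g(2) \<epsilon>_def closed A.inv_mult intro!: restrict_ext)
      ultimately show ?thesis
        unfolding braided_B2_def by blast
    qed
  qed
  have "braided_B2 X \<sigma> A \<subseteq> braided_Z2 X \<sigma> A"
  proof
    fix f assume f: "f \<in> braided_B2 X \<sigma> A"
    then obtain \<gamma> where g: "\<gamma> \<in> carrier (Fun_group X A)"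
      "f = (\<lambda>(x, y)\<in>X \<times> X. \<gamma> (tdot X \<sigma> x y) \<otimes>\<^bsub>A\<^esub> inv\<^bsub>A\<^esub> \<gamma> y)"
      unfolding braided_B2_def by blast
    have val: "\<gamma> x \<in> carrier A" if "x \<in> X" for x
      using g that by auto
    have telescope: "(a \<otimes>\<^bsub>A\<^esub> inv\<^bsub>A\<^esub> b) \<otimes>\<^bsub>A\<^esub> (c \<otimes>\<^bsub>A\<^esub> inv\<^bsub>A\<^esub> a) = c \<otimes>\<^bsub>A\<^esub> inv\<^bsub>A\<^esub> b"
      if "a \<in> carrier A" "b \<in> carrier A" "c \<in> carrier A" for a b c
    proof -
      have "(a \<otimes>\<^bsub>A\<^esub> inv\<^bsub>A\<^esub> b) \<otimes>\<^bsub>A\<^esub> (c \<otimes>\<^bsub>A\<^esub> inv\<^bsub>A\<^esub> a) = (a \<otimes>\<^bsub>A\<^esub> inv\<^bsub>A\<^esub> a) \<otimes>\<^bsub>A\<^esub> (c \<otimes>\<^bsub>A\<^esub> inv\<^bsub>A\<^esub> b)"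
        using that by (simp only: A.m_ac A.inv_closed A.m_closed)
      then show ?thesis
        using that by simp
    qed
    have "f \<in> X \<times> X \<rightarrow>\<^sub>E carrier A"
      using f subC by auto
    then show "f \<in> braided_Z2 X \<sigma> A"
      by (auto simp: braided_Z2_def g(2) closed val telescope dot_tdot_tdot)
  qed
  with C Z B show ?thesis
    unfolding braided_H2_def by (rule comm_group_subquotient)
qed

end

end

theory Submission
  imports Defs
begin

text \<open>
  A 1-cocycle \<open>\<theta>\<close> on a presented group is determined by its values on the generators, and values
  prescribed on the generators extend to a cocycle if and only if the extension to words respects
  the relations. For the structure group, write \<open>\<theta> x z = f (x, z)\<close>. The relation
  \<open>(y \<cdot> x) y = (x \<cdot>\<^sup>~ y) x\<close> then becomes the defining equation of \<open>Z\<^sup>2\<close>, evaluated at \<open>z\<close>. So restriction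
  to the generators is an isomorphism \<open>Z\<^sup>1 \<cong> Z\<^sup>2\<close>. It sends the coboundary of \<open>m\<close> to the braided
  coboundary of \<open>-m\<close>, hence \<open>B\<^sup>1\<close> onto \<open>B\<^sup>2\<close>.
\<close>

section \<open>Quotients under an isomorphism\<close>

lemma Mod_iso_image:
  assumes "h \<in> iso G H" "group H" "N \<lhd> G"
  shows "G Mod N \<cong> H Mod h ` N"
proof -
  interpret N: normal N G by fact
  have hN: "h ` N \<lhd> H"
    using iso_normal_subgroup[OF assms(1) N.is_group assms(2,3)] .
  interpret hN: normal "h ` N" H by fact
  interpret h: group_hom G H h
    using assms by unfold_locales (auto simp: iso_def)
  have inj: "inj_on h (carrier G)" and surj: "h ` carrier G = carrier H"
    using assms by (auto simp: iso_def bij_betw_def)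
  \<comment> \<open>The first isomorphism theorem will be applied to \<open>?k\<close>, which is
    \<open>h\<close> followed by the projection modulo the image of \<open>N\<close>. It is onto,
    and injectivity of \<open>h\<close> makes its kernel equal to \<open>N\<close>.\<close>
  let ?k = "(\<lambda>y. h ` N #>\<^bsub>H\<^esub> y) \<circ> h"
  have "?k \<in> hom G (H Mod h ` N)"
    using hom_compose[OF h.homh hN.r_coset_hom_Mod] .
  then interpret k: group_hom G "H Mod h ` N" ?k
    using hN.factorgroup_is_group by (intro group_hom.intro N.is_group group_hom_axioms.intro)
  have "?k ` carrier G = carrier (H Mod h ` N)"
    by (simp only: carrier_FactGroup image_comp flip: surj)
  moreover have "kernel G (H Mod h ` N) ?k = N"
  proof -
    have "h ` N #>\<^bsub>H\<^esub> h x = h ` N \<longleftrightarrow> x \<in> N" if "x \<in> carrier G" for x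
    proof -
      have "h ` N #>\<^bsub>H\<^esub> h x = h ` N \<longleftrightarrow> h x \<in> h ` N"
        using that hN.coset_join1 hN.coset_join2 hN.subgroup_axioms h.hom_closed by metis
      also have "\<dots> \<longleftrightarrow> x \<in> N"
        by (rule inj_on_image_mem_iff[OF inj that N.subset])
      finally show ?thesis .
    qed
    then show ?thesis
      using N.subset by (auto simp: kernel_def)
  qed
  ultimately show ?thesis
    using k.FactGroup_iso by metis
qed


section \<open>Cocycles on presented groups\<close>

locale presented_group_module = right_group_module "presented_group X R" M act
  for X :: "'x set" and R :: "('x sword \<times> 'x sword) set"
    and M :: "('v, 'n) monoid_scheme" (structure) and act :: "'v \<Rightarrow> 'x sword set \<Rightarrow> 'v"
begin

text \<open>The value at \<open>x\<inverse>\<close> is forced by \<open>0 = \<theta> (x x\<inverse>) = \<theta> (x\<inverse>) + \<theta> x x\<inverse>\<close>.\<close>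

definition letter_value :: "('x \<Rightarrow> 'v) \<Rightarrow> 'x \<times> bool \<Rightarrow> 'v" where
  "letter_value c p =
    (if snd p then c (fst p) else inv\<^bsub>M\<^esub> act (c (fst p)) (word_class X R [p]))"

text \<open>The recursion is the cocycle rule for the product of the first letter with the rest, so
  this is the only candidate for a cocycle with the values \<open>c\<close> on generators.\<close>

primrec word_value :: "('x \<Rightarrow> 'v) \<Rightarrow> 'x sword \<Rightarrow> 'v" where
  "word_value c [] = \<one>\<^bsub>M\<^esub>"
| "word_value c (p # u) = word_value c u \<otimes>\<^bsub>M\<^esub> act (letter_value c p) (word_class X R u)"

section \<open>Extending generator values to a cocycle\<close>

lemma word_class_in_carrier: "u \<in> swords X \<Longrightarrow> word_class X R u \<in> carrier (presented_group X R)"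
  by (simp add: carrier_presented_group)

lemma act_word_class_closed:
  "\<lbrakk>m \<in> carrier M; u \<in> swords X\<rbrakk> \<Longrightarrow> act m (word_class X R u) \<in> carrier M"
  by (simp add: act_closed word_class_in_carrier)

lemma act_word_class_Nil: "m \<in> carrier M \<Longrightarrow> act m (word_class X R []) = m"
  using act_one by (simp add: one_presented_group)

lemma act_word_class_append:
  "\<lbrakk>m \<in> carrier M; u \<in> swords X; v \<in> swords X\<rbrakk> \<Longrightarrow>
    act m (word_class X R (u @ v)) = act (act m (word_class X R u)) (word_class X R v)"
  using act_mult[of m "word_class X R u" "word_class X R v"]
  by (simp add: mult_presented_group word_class_in_carrier)

lemma letter_value_closed:
  assumes "c \<in> X \<rightarrow> carrier M" "fst p \<in> X"
  shows "letter_value c p \<in> carrier M"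
  using assms by (auto simp: letter_value_def intro!: act_word_class_closed)

lemma word_value_closed:
  assumes "c \<in> X \<rightarrow> carrier M" "u \<in> swords X"
  shows "word_value c u \<in> carrier M"
  using assms(2) by (induction u) (auto simp: letter_value_closed[OF assms(1)] act_word_class_closed)

text \<open>This is the cocycle rule on words, before values are known to depend only on classes. In
  the induction, \<open>u\<close> and then \<open>v\<close> act on the value of the head letter,
  which is the action of \<open>u @ v\<close>.\<close>

lemma word_value_append:
  assumes c: "c \<in> X \<rightarrow> carrier M" and "u \<in> swords X" and v: "v \<in> swords X"
  shows "word_value c (u @ v) = word_value c v \<otimes>\<^bsub>M\<^esub> act (word_value c u) (word_class X R v)"
  using assms(2)
proof (induction u)
  case Nil
  then show ?case
    using c v by (simp add: act_neutral word_class_in_carrier word_value_closed)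
next
  case (Cons p u)
  then show ?case
    using c v
    by (simp add: act_add act_word_class_append act_word_class_closed letter_value_closed
        word_value_closed word_class_in_carrier M.m_assoc)
qed

lemma word_class_cancel:
  assumes "x \<in> X"
  shows "word_class X R [(x, e), (x, \<not> e)] = word_class X R []"
  using assms by (simp add: word_class_eq_iff word_cong.cancel)

lemma word_value_cancel:
  assumes c: "c \<in> X \<rightarrow> carrier M" and x: "x \<in> X"
  shows "word_value c [(x, e), (x, \<not> e)] = \<one>\<^bsub>M\<^esub>"
proof -
  have cx: "c x \<in> carrier M"
    using c x by auto
  \<comment> \<open>This serves \<open>e = False\<close>, where the value is \<open>c x\<close>
    minus this element. For \<open>e = True\<close> the two terms are inverse by the definition of
    \<open>letter_value\<close>.\<close>
  have "act (act (c x) (word_class X R [(x, False)])) (word_class X R [(x, True)]) = c x"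
    using word_class_cancel[OF x, of False] act_word_class_append[of "c x" "[(x, False)]" "[(x, True)]"] cx x
    by (simp add: act_word_class_Nil)
  then show ?thesis
    using cx x
    by (cases e) (simp_all add: letter_value_def act_word_class_Nil act_word_class_closed act_inv
        word_class_in_carrier)
qed

text \<open>Induction over the least congruence leaves only the pairs in \<open>R\<close>, the
  cancellations and concatenation to check.\<close>

lemma word_value_cong:
  assumes c: "c \<in> X \<rightarrow> carrier M"
    and R: "\<And>u v. \<lbrakk>(u, v) \<in> R; u \<in> swords X; v \<in> swords X\<rbrakk> \<Longrightarrow> word_value c u = word_value c v"
    and uv: "(u, v) \<in> word_cong X R"
  shows "word_value c u = word_value c v"
  using uv
proof (induction rule: word_cong.induct)
  case (cancel x e)
  show ?case
    using word_value_cancel[OF c cancel] by simp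
next
  case (append u u' v v')
  then have "u \<in> swords X" "u' \<in> swords X" "v \<in> swords X" "v' \<in> swords X"
    using word_cong_in_swords by blast+
  \<comment> \<open>In \<open>word_value_append\<close> the second factor also acts, so its class
    must agree and not only its value.\<close>
  moreover from this append have "word_class X R v = word_class X R v'"
    by (simp add: word_class_eq_iff)
  ultimately show ?case
    using append by (simp add: word_value_append[OF c])
qed (auto simp: R)

text \<open>\<open>word_value c\<close> descends to classes by \<open>word_value_cong\<close>, and
  \<open>word_value_append\<close> then becomes the cocycle rule.\<close>

lemma ex_Z1_on_generators:
  assumes c: "c \<in> X \<rightarrow> carrier M"
    and R: "\<And>u v. \<lbrakk>(u, v) \<in> R; u \<in> swords X; v \<in> swords X\<rbrakk> \<Longrightarrow> word_value c u = word_value c v"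
  obtains \<theta> where "\<theta> \<in> group_Z1 (presented_group X R) M act"
    "\<And>x. x \<in> X \<Longrightarrow> \<theta> (word_class X R [(x, True)]) = c x"
proof -
  \<comment> \<open>An arbitrary representative is chosen; the next step shows that the choice does
    not matter.\<close>
  define \<theta> where "\<theta> = (\<lambda>g\<in>carrier (presented_group X R).
    word_value c (SOME u. u \<in> swords X \<and> word_class X R u = g))"
  have \<theta>: "\<theta> (word_class X R u) = word_value c u" if u: "u \<in> swords X" for u
  proof -
    let ?v = "SOME v. v \<in> swords X \<and> word_class X R v = word_class X R u"
    have "?v \<in> swords X \<and> word_class X R ?v = word_class X R u"
      by (rule someI[of _ u]) (simp add: u)
    then have "word_value c ?v = word_value c u"
      using u by (intro word_value_cong[OF c R]) (auto simp: word_class_eq_iff)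
    then show ?thesis
      using u by (simp add: \<theta>_def word_class_in_carrier)
  qed
  have "\<theta> \<in> extensional (carrier (presented_group X R))"
    by (simp add: \<theta>_def)
  then have "\<theta> \<in> group_Z1 (presented_group X R) M act"
    by (auto simp: group_Z1_def carrier_presented_group PiE_iff mult_presented_group \<theta>
        word_value_closed[OF c] word_value_append[OF c])
  moreover have "\<theta> (word_class X R [(x, True)]) = c x" if "x \<in> X" for x
  proof -
    have "c x \<in> carrier M"
      using c that by auto
    then show ?thesis
      using that by (simp add: \<theta> letter_value_def act_word_class_Nil)
  qed
  ultimately show thesis
    by (rule that)
qed

section \<open>Uniqueness of the extension\<close>

lemma Z1_closed:
  "\<lbrakk>\<theta> \<in> group_Z1 (presented_group X R) M act; u \<in> swords X\<rbrakk> \<Longrightarrow> \<theta> (word_class X R u) \<in> carrier M"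
  by (auto simp: group_Z1_def word_class_in_carrier)

lemma Z1_append:
  assumes "\<theta> \<in> group_Z1 (presented_group X R) M act" "u \<in> swords X" "v \<in> swords X"
  shows "\<theta> (word_class X R (u @ v)) =
    \<theta> (word_class X R v) \<otimes>\<^bsub>M\<^esub> act (\<theta> (word_class X R u)) (word_class X R v)"
  using assms by (simp add: group_Z1_def word_class_in_carrier flip: mult_presented_group)

text \<open>The cocycle rule for the identity times itself reads \<open>t = t + t\<close>, where
  \<open>t\<close> is the value there.\<close>

lemma Z1_Nil:
  assumes "\<theta> \<in> group_Z1 (presented_group X R) M act"
  shows "\<theta> (word_class X R []) = \<one>\<^bsub>M\<^esub>"
  using Z1_append[OF assms, of "[]" "[]"] Z1_closed[OF assms, of "[]"]
  by (simp add: act_word_class_Nil)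

text \<open>Both sides obey the same rule when a letter is prepended, so it suffices to compare
  single letters, and only inverse letters need an argument.\<close>

lemma Z1_eq_word_value:
  assumes \<theta>: "\<theta> \<in> group_Z1 (presented_group X R) M act" and u: "u \<in> swords X"
  shows "\<theta> (word_class X R u) = word_value (\<lambda>x. \<theta> (word_class X R [(x, True)])) u"
  using u
proof (induction u)
  case Nil
  show ?case
    by (simp add: Z1_Nil[OF \<theta>])
next
  case (Cons p u)
  have "\<theta> (word_class X R [p]) = letter_value (\<lambda>x. \<theta> (word_class X R [(x, True)])) p"
  proof (cases "snd p")
    case True
    then show ?thesis
      by (cases p) (simp add: letter_value_def)
  next
    case False
    then obtain x where p: "p = (x, False)" and x: "x \<in> X"
      using Cons.prems by (cases p) auto
    \<comment> \<open>Expanding the value at the trivial product of \<open>x\<close> and its inverse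
      leaves an equation to be solved for the value at the inverse.\<close>
    have "\<theta> (word_class X R [(x, False)]) \<otimes>\<^bsub>M\<^esub>
        act (\<theta> (word_class X R [(x, True)])) (word_class X R [(x, False)]) = \<one>\<^bsub>M\<^esub>"
      using Z1_append[OF \<theta>, of "[(x, True)]" "[(x, False)]"] x word_class_cancel[OF x, of True]
      by (simp add: Z1_Nil[OF \<theta>])
    then show ?thesis
      using x by (simp add: p letter_value_def M.inv_equality Z1_closed[OF \<theta>] act_word_class_closed)
  qed
  then show ?case
    using Cons Z1_append[OF \<theta>, of "[p]" u] by simp
qed

lemma Z1_eqI:
  assumes \<theta>: "\<theta> \<in> group_Z1 (presented_group X R) M act"
    and \<eta>: "\<eta> \<in> group_Z1 (presented_group X R) M act"
    and eq: "\<And>x. x \<in> X \<Longrightarrow> \<theta> (word_class X R [(x, True)]) = \<eta> (word_class X R [(x, True)])"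
  shows "\<theta> = \<eta>"
proof (rule extensionalityI)
  show "\<theta> \<in> extensional (carrier (presented_group X R))" "\<eta> \<in> extensional (carrier (presented_group X R))"
    using \<theta> \<eta> by (auto simp: group_Z1_def PiE_iff)
  fix g assume "g \<in> carrier (presented_group X R)"
  then obtain u where u: "u \<in> swords X" "g = word_class X R u"
    by (auto simp: carrier_presented_group)
  have "word_value (\<lambda>x. \<theta> (word_class X R [(x, True)])) u =
      word_value (\<lambda>x. \<eta> (word_class X R [(x, True)])) u"
    using u(1) by (induction u) (auto simp: letter_value_def eq)
  then show "\<theta> g = \<eta> g"
    using u by (simp add: Z1_eq_word_value[OF \<theta>] Z1_eq_word_value[OF \<eta>])
qed

end


section \<open>Restriction to the generators\<close>

text \<open>Function-valued data on generators is uncurried here, since braided 2-cochains take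
  pairs.\<close>

definition gen_restrict ::
  "'x set \<Rightarrow> ('x \<times> 'x \<Rightarrow> 'x \<times> 'x) \<Rightarrow> ('x sword set \<Rightarrow> 'x \<Rightarrow> 'a) \<Rightarrow> 'x \<times> 'x \<Rightarrow> 'a" where
  "gen_restrict X \<sigma> \<theta> = (\<lambda>(x, z)\<in>X \<times> X. \<theta> (structure_gen X \<sigma> x) z)"

context left_nondegenerate_braided_set
begin

lemma structure_gen_closed: "x \<in> X \<Longrightarrow> structure_gen X \<sigma> x \<in> carrier (structure_group X \<sigma>)"
  by (simp add: structure_gen_def structure_group_def carrier_presented_group)

lemma presented_group_module_Fun:
  assumes "comm_group A"
  shows "presented_group_module X (structure_relations X \<sigma>) (Fun_group X A) (Fun_act X \<sigma>)"
  using Fun_right_module[OF assms] by (simp add: presented_group_module_def structure_group_def)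

text \<open>The substitution \<open>a = tdot X \<sigma> x y\<close>, \<open>b = x\<close> turns the relation \<open>a b = (lact a b) (ract a b)\<close>
  into \<open>(tdot x y) x = (dot y x) y\<close>.\<close>

lemma braided_Z2_iff:
  "f \<in> braided_Z2 X \<sigma> A \<longleftrightarrow> f \<in> X \<times> X \<rightarrow>\<^sub>E carrier A \<and>
    (\<forall>a\<in>X. \<forall>b\<in>X. \<forall>z\<in>X.
      f (b, z) \<otimes>\<^bsub>A\<^esub> f (a, tdot X \<sigma> b z) =
      f (ract \<sigma> a b, z) \<otimes>\<^bsub>A\<^esub> f (lact \<sigma> a b, tdot X \<sigma> (ract \<sigma> a b) z))"
    (is "_ \<longleftrightarrow> _ \<and> ?rel")
proof -
  have "?rel \<longleftrightarrow> (\<forall>x\<in>X. \<forall>y\<in>X. \<forall>z\<in>X.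
      f (x, z) \<otimes>\<^bsub>A\<^esub> f (tdot X \<sigma> x y, tdot X \<sigma> x z) =
      f (y, z) \<otimes>\<^bsub>A\<^esub> f (dot X \<sigma> y x, tdot X \<sigma> y z))" (is "_ \<longleftrightarrow> ?coc")
  proof
    assume ?rel
    then show ?coc
      by (metis dot_def ract_tdot tdot_closed)
  next
    assume ?coc
    then show ?rel
      by (metis dot_def ract_closed tdot_ract)
  qed
  then show ?thesis
    by (auto simp: braided_Z2_def)
qed

lemma gen_restrict_hom:
  "gen_restrict X \<sigma> \<in> hom (product_group (carrier (structure_group X \<sigma>)) (\<lambda>_. Fun_group X A))
     (product_group (X \<times> X) (\<lambda>_. A))"
proof (rule homI)
  fix \<theta> \<eta>
  assume \<theta>: "\<theta> \<in> carrier (product_group (carrier (structure_group X \<sigma>)) (\<lambda>_. Fun_group X A))"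
  have "\<theta> (structure_gen X \<sigma> x) z \<in> carrier A" if "x \<in> X" "z \<in> X" for x z
    using \<theta> structure_gen_closed[OF that(1)] that(2) by (auto simp: PiE_iff)
  then show "gen_restrict X \<sigma> \<theta> \<in> carrier (product_group (X \<times> X) (\<lambda>_. A))"
    by (auto simp: gen_restrict_def)
  show "gen_restrict X \<sigma> (\<theta> \<otimes>\<^bsub>product_group (carrier (structure_group X \<sigma>)) (\<lambda>_. Fun_group X A)\<^esub> \<eta>) =
      gen_restrict X \<sigma> \<theta> \<otimes>\<^bsub>product_group (X \<times> X) (\<lambda>_. A)\<^esub> gen_restrict X \<sigma> \<eta>"
    by (auto simp: gen_restrict_def structure_gen_closed intro!: restrict_ext)
qed

text \<open>The generator \<open>b\<close> acts on \<open>c a\<close> by precomposition with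
  \<open>tdot X \<sigma> b\<close>. For the two words of a structure relation, this formula yields
  the two sides of the equation in \<open>braided_Z2_iff\<close>.\<close>

lemma word_value_two_generators:
  assumes A: "comm_group A" and c: "c \<in> X \<rightarrow> carrier (Fun_group X A)"
    and "a \<in> X" "b \<in> X"
  shows "presented_group_module.word_value X (structure_relations X \<sigma>) (Fun_group X A) (Fun_act X \<sigma>)
      c [(a, True), (b, True)] = (\<lambda>z\<in>X. c b z \<otimes>\<^bsub>A\<^esub> c a (tdot X \<sigma> b z))"
proof -
  interpret presented_group_module X "structure_relations X \<sigma>" "Fun_group X A" "Fun_act X \<sigma>"
    using A by (rule presented_group_module_Fun)
  have ca: "c a \<in> X \<rightarrow>\<^sub>E carrier A" and cb: "c b \<in> carrier (Fun_group X A)"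
    using assms by auto
  then show ?thesis
    using assms M.l_one[OF cb]
    by (auto simp: letter_value_def act_word_class_Nil Fun_act_word_class simp del: one_product_group
        intro!: restrict_ext)
qed

section \<open>Restriction on cocycles and on coboundaries\<close>

lemma inj_on_gen_restrict:
  assumes "comm_group A"
  shows "inj_on (gen_restrict X \<sigma>) (group_Z1 (structure_group X \<sigma>) (Fun_group X A) (Fun_act X \<sigma>))"
proof (rule inj_onI)
  interpret presented_group_module X "structure_relations X \<sigma>" "Fun_group X A" "Fun_act X \<sigma>"
    using assms by (rule presented_group_module_Fun)
  fix \<theta> \<eta> assume \<theta>: "\<theta> \<in> group_Z1 (structure_group X \<sigma>) (Fun_group X A) (Fun_act X \<sigma>)"
    and \<eta>: "\<eta> \<in> group_Z1 (structure_group X \<sigma>) (Fun_group X A) (Fun_act X \<sigma>)"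
    and eq: "gen_restrict X \<sigma> \<theta> = gen_restrict X \<sigma> \<eta>"
  \<comment> \<open>\<open>Z1_eqI\<close> needs equality of whole functions: on \<open>X\<close> it
    is read off from pairs, and outside \<open>X\<close> both are undefined.\<close>
  have "\<theta> (structure_gen X \<sigma> x) = \<eta> (structure_gen X \<sigma> x)" if x: "x \<in> X" for x
  proof (rule extensionalityI)
    show "\<theta> (structure_gen X \<sigma> x) \<in> extensional X" "\<eta> (structure_gen X \<sigma> x) \<in> extensional X"
      using \<theta> \<eta> structure_gen_closed[OF x] by (auto simp: group_Z1_def PiE_iff)
    show "\<theta> (structure_gen X \<sigma> x) z = \<eta> (structure_gen X \<sigma> x) z" if "z \<in> X" for z
      using fun_cong[OF eq, of "(x, z)"] x that by (simp add: gen_restrict_def)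
  qed
  then show "\<theta> = \<eta>"
    using \<theta> \<eta> by (intro Z1_eqI) (auto simp: structure_group_def structure_gen_def)
qed

text \<open>One inclusion evaluates a cocycle on the two words of a relation, which name the same
  group element. The other curries \<open>f\<close> and extends it by
  \<open>ex_Z1_on_generators\<close>, where the braided cocycle equation is compatibility with the
  relations.\<close>

lemma gen_restrict_Z1:
  assumes "comm_group A"
  shows "gen_restrict X \<sigma> ` group_Z1 (structure_group X \<sigma>) (Fun_group X A) (Fun_act X \<sigma>) =
    braided_Z2 X \<sigma> A"
proof
  interpret presented_group_module X "structure_relations X \<sigma>" "Fun_group X A" "Fun_act X \<sigma>"
    using assms by (rule presented_group_module_Fun)
  show "gen_restrict X \<sigma> ` group_Z1 (structure_group X \<sigma>) (Fun_group X A) (Fun_act X \<sigma>) \<subseteq>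
    braided_Z2 X \<sigma> A"
  proof
    fix f assume "f \<in> gen_restrict X \<sigma> ` group_Z1 (structure_group X \<sigma>) (Fun_group X A) (Fun_act X \<sigma>)"
    then obtain \<theta> where \<theta>: "\<theta> \<in> group_Z1 (structure_group X \<sigma>) (Fun_group X A) (Fun_act X \<sigma>)"
      and f: "f = gen_restrict X \<sigma> \<theta>"
      by blast
    note \<theta>' = \<theta>[unfolded structure_group_def]
    define c where "c x = \<theta> (structure_gen X \<sigma> x)" for x
    have c: "c \<in> X \<rightarrow> carrier (Fun_group X A)"
      using \<theta> structure_gen_closed by (auto simp: group_Z1_def c_def PiE_iff)
    have fc: "f (x, z) = c x z" if "x \<in> X" "z \<in> X" for x z
      using that by (simp add: f gen_restrict_def c_def)
    \<comment> \<open>Used for \<open>a\<close>, \<open>b\<close> and again for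
      \<open>lact \<sigma> a b\<close>, \<open>ract \<sigma> a b\<close>, this gives both sides of
      the equation.\<close>
    have rel_side: "\<theta> (word_class X (structure_relations X \<sigma>) [(a, True), (b, True)]) z =
        f (b, z) \<otimes>\<^bsub>A\<^esub> f (a, tdot X \<sigma> b z)" if "a \<in> X" "b \<in> X" "z \<in> X" for a b z
    proof -
      have "\<theta> (word_class X (structure_relations X \<sigma>) [(a, True), (b, True)]) =
          word_value c [(a, True), (b, True)]"
        unfolding c_def structure_gen_def using that by (intro Z1_eq_word_value[OF \<theta>']) simp
      then show ?thesis
        using that word_value_two_generators[OF assms c that(1,2)] by (simp add: fc tdot_closed)
    qed
    have "f \<in> X \<times> X \<rightarrow>\<^sub>E carrier A"
      using gen_restrict_hom[of A] \<theta> by (auto simp: f group_Z1_def hom_def Pi_iff)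
    moreover have "f (b, z) \<otimes>\<^bsub>A\<^esub> f (a, tdot X \<sigma> b z) =
        f (ract \<sigma> a b, z) \<otimes>\<^bsub>A\<^esub> f (lact \<sigma> a b, tdot X \<sigma> (ract \<sigma> a b) z)"
      if abz: "a \<in> X" "b \<in> X" "z \<in> X" for a b z
    proof -
      have "word_class X (structure_relations X \<sigma>) [(a, True), (b, True)] =
          word_class X (structure_relations X \<sigma>) [(lact \<sigma> a b, True), (ract \<sigma> a b, True)]"
        using abz
        by (subst word_class_eq_iff)
          (auto simp: structure_relations_def lact_closed ract_closed intro!: word_cong.rel)
      then show ?thesis
        using abz by (metis rel_side lact_closed ract_closed)
    qed
    ultimately show "f \<in> braided_Z2 X \<sigma> A"
      by (simp add: braided_Z2_iff)
  qed
  show "braided_Z2 X \<sigma> A \<subseteq>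
    gen_restrict X \<sigma> ` group_Z1 (structure_group X \<sigma>) (Fun_group X A) (Fun_act X \<sigma>)"
  proof
    fix f assume f: "f \<in> braided_Z2 X \<sigma> A"
    \<comment> \<open>Restricting to \<open>X\<close> makes \<open>c x\<close> extensional, hence an
      element of \<open>Fun_group X A\<close>.\<close>
    define c where "c x = (\<lambda>z\<in>X. f (x, z))" for x
    have c: "c \<in> X \<rightarrow> carrier (Fun_group X A)"
      using f by (auto simp: c_def braided_Z2_def)
    have "word_value c u = word_value c v" if uv: "(u, v) \<in> structure_relations X \<sigma>" for u v
    proof -
      obtain a b where ab: "a \<in> X" "b \<in> X" "u = [(a, True), (b, True)]"
        "v = [(lact \<sigma> a b, True), (ract \<sigma> a b, True)]"
        using uv unfolding structure_relations_def by blast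
      then show ?thesis
        using f
        unfolding ab(3,4) word_value_two_generators[OF assms c ab(1,2)]
          word_value_two_generators[OF assms c lact_closed[OF ab(1,2)] ract_closed[OF ab(1,2)]]
        by (auto simp: braided_Z2_iff c_def lact_closed ract_closed tdot_closed intro!: restrict_ext)
    qed
    then obtain \<theta> where \<theta>: "\<theta> \<in> group_Z1 (structure_group X \<sigma>) (Fun_group X A) (Fun_act X \<sigma>)"
      "\<And>x. x \<in> X \<Longrightarrow> \<theta> (structure_gen X \<sigma> x) = c x"
      unfolding structure_group_def structure_gen_def using ex_Z1_on_generators[OF c] by metis
    have "f \<in> extensional (X \<times> X)"
      using f by (simp add: braided_Z2_def PiE_iff)
    then have "gen_restrict X \<sigma> \<theta> = f"
      by (intro extensionalityI[of _ "X \<times> X"]) (auto simp: gen_restrict_def \<theta> c_def)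
    with \<theta> show "f \<in> gen_restrict X \<sigma> ` group_Z1 (structure_group X \<sigma>) (Fun_group X A) (Fun_act X \<sigma>)"
      by blast
  qed
qed

text \<open>The two coboundary conventions have opposite signs: the group one subtracts the
  translate, the braided one subtracts the original function.\<close>

lemma gen_restrict_B1:
  assumes "comm_group A"
  shows "gen_restrict X \<sigma> ` group_B1 (structure_group X \<sigma>) (Fun_group X A) (Fun_act X \<sigma>) =
    braided_B2 X \<sigma> A"
proof -
  interpret A: comm_group A by fact
  interpret F: right_group_module "structure_group X \<sigma>" "Fun_group X A" "Fun_act X \<sigma>"
    using assms by (rule Fun_right_module)
  define cob where "cob m = (\<lambda>g\<in>carrier (structure_group X \<sigma>).
    m \<otimes>\<^bsub>Fun_group X A\<^esub> inv\<^bsub>Fun_group X A\<^esub> Fun_act X \<sigma> m g)" for m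
  define bcob where "bcob \<gamma> = (\<lambda>(x, y)\<in>X \<times> X. \<gamma> (tdot X \<sigma> x y) \<otimes>\<^bsub>A\<^esub> inv\<^bsub>A\<^esub> \<gamma> y)" for \<gamma>
  have inv_Fun: "(inv\<^bsub>Fun_group X A\<^esub> m) z = inv\<^bsub>A\<^esub> m z" if "m \<in> carrier (Fun_group X A)" "z \<in> X" for m z
    using that inv_product_group[of m X "\<lambda>_. A"] by simp
  have cob: "gen_restrict X \<sigma> (cob m) = bcob (inv\<^bsub>Fun_group X A\<^esub> m)"
    if m: "m \<in> carrier (Fun_group X A)" for m
  proof -
    have "cob m (structure_gen X \<sigma> x) z =
        (inv\<^bsub>Fun_group X A\<^esub> m) (tdot X \<sigma> x z) \<otimes>\<^bsub>A\<^esub> inv\<^bsub>A\<^esub> (inv\<^bsub>Fun_group X A\<^esub> m) z"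
      if xz: "x \<in> X" "z \<in> X" for x z
    proof -
      have val: "m y \<in> carrier A" if "y \<in> X" for y
        using m that by auto
      have "Fun_act X \<sigma> m (structure_gen X \<sigma> x) \<in> carrier (Fun_group X A)"
        using m xz by (intro F.act_closed structure_gen_closed)
      then have "(inv\<^bsub>Fun_group X A\<^esub> Fun_act X \<sigma> m (structure_gen X \<sigma> x)) z = inv\<^bsub>A\<^esub> m (tdot X \<sigma> x z)"
        using xz by (simp only: inv_Fun Fun_act_gen[OF m])
      moreover have "cob m (structure_gen X \<sigma> x) z =
          m z \<otimes>\<^bsub>A\<^esub> (inv\<^bsub>Fun_group X A\<^esub> Fun_act X \<sigma> m (structure_gen X \<sigma> x)) z"
        using xz by (simp add: cob_def structure_gen_closed)
      ultimately have "cob m (structure_gen X \<sigma> x) z = m z \<otimes>\<^bsub>A\<^esub> inv\<^bsub>A\<^esub> m (tdot X \<sigma> x z)"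
        by (simp only:)
      \<comment> \<open>Commutativity of \<open>A\<close> and double inversion turn
        \<open>m z\<close> minus \<open>m (tdot X \<sigma> x z)\<close> into the braided coboundary
        of the inverse of \<open>m\<close>.\<close>
      then show ?thesis
        using xz by (simp only: inv_Fun[OF m] val tdot_closed A.inv_inv A.inv_closed A.m_comm)
    qed
    then show ?thesis
      by (auto simp: gen_restrict_def bcob_def intro!: restrict_ext)
  qed
  have "gen_restrict X \<sigma> ` cob ` carrier (Fun_group X A) =
      bcob ` (\<lambda>m. inv\<^bsub>Fun_group X A\<^esub> m) ` carrier (Fun_group X A)"
    unfolding image_image by (intro image_cong HOL.refl cob)
  \<comment> \<open>Inversion is an involution, so the sign change loses no coboundary.\<close>
  also have "(\<lambda>m. inv\<^bsub>Fun_group X A\<^esub> m) ` carrier (Fun_group X A) = carrier (Fun_group X A)"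
  proof
    show "carrier (Fun_group X A) \<subseteq> (\<lambda>m. inv\<^bsub>Fun_group X A\<^esub> m) ` carrier (Fun_group X A)"
      by (metis F.M.inv_closed F.M.inv_inv image_eqI subsetI)
  qed (rule image_subsetI, rule F.M.inv_closed)
  finally have "gen_restrict X \<sigma> ` cob ` carrier (Fun_group X A) = bcob ` carrier (Fun_group X A)" .
  moreover have "group_B1 (structure_group X \<sigma>) (Fun_group X A) (Fun_act X \<sigma>) =
      cob ` carrier (Fun_group X A)"
    unfolding group_B1_def cob_def by (rule Setcompr_eq_image)
  moreover have "braided_B2 X \<sigma> A = bcob ` carrier (Fun_group X A)"
    unfolding braided_B2_def bcob_def by (rule Setcompr_eq_image)
  ultimately show ?thesis
    by simp
qed

end

section \<open>Passage to cohomology\<close>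

theorem theorem11p2:
  fixes X :: "'x set" and \<sigma> :: "'x \<times> 'x \<Rightarrow> 'x \<times> 'x" and A :: "('a, 'm) monoid_scheme"
  assumes "left_nondegenerate_braided_set X \<sigma>" and "comm_group A"
  shows "braided_H2 X \<sigma> A \<cong> group_H1 (structure_group X \<sigma>) (Fun_group X A) (Fun_act X \<sigma>)"
proof -
  interpret left_nondegenerate_braided_set X \<sigma> by fact
  let ?G = "structure_group X \<sigma>" and ?M = "Fun_group X A" and ?act = "Fun_act X \<sigma>"
  interpret F: right_group_module ?G ?M ?act
    using assms(2) by (rule Fun_right_module)
  let ?C1 = "product_group (carrier ?G) (\<lambda>_. ?M)" and ?C2 = "product_group (X \<times> X) (\<lambda>_. A)"
  let ?Z1 = "?C1\<lparr>carrier := group_Z1 ?G ?M ?act\<rparr>" and ?Z2 = "?C2\<lparr>carrier := braided_Z2 X \<sigma> A\<rparr>"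
  interpret C1: comm_group ?C1
    by (rule F.comm_group_cochains)
  interpret C2: comm_group ?C2
    using assms(2) by (intro comm_group_product_group)
  interpret r: group_hom ?C1 ?C2 "gen_restrict X \<sigma>"
    using gen_restrict_hom by unfold_locales
  \<comment> \<open>The induced homomorphism lands on the image of the cocycles, which
    \<open>gen_restrict_Z1\<close> identifies with all of
    \<open>braided_Z2 X \<sigma> A\<close>.\<close>
  interpret rZ: group_hom ?Z1 ?Z2 "gen_restrict X \<sigma>"
    using r.induced_group_hom[OF F.subgroup_Z1] by (simp add: gen_restrict_Z1 assms(2))
  have "gen_restrict X \<sigma> \<in> iso ?Z1 ?Z2"
    using rZ.homh inj_on_gen_restrict[OF assms(2)] gen_restrict_Z1[OF assms(2)]
    by (simp add: iso_def bij_betw_def)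
  \<comment> \<open>The cocycle group is commutative, so each of its subgroups is normal.\<close>
  moreover have "group_B1 ?G ?M ?act \<lhd> ?Z1"
    using C1.subgroup_incl[OF F.subgroup_B1 F.subgroup_Z1 F.B1_subset_Z1] C1.m_comm
      subgroup.mem_carrier[OF F.subgroup_Z1]
    by (intro comm_group.normal_iff_subgroup[THEN iffD2] group.group_comm_groupI rZ.G.is_group)
      (simp_all del: carrier_product_group mult_product_group)
  ultimately have "?Z1 Mod group_B1 ?G ?M ?act \<cong> ?Z2 Mod gen_restrict X \<sigma> ` group_B1 ?G ?M ?act"
    by (intro Mod_iso_image rZ.H.is_group)
  then have "?Z1 Mod group_B1 ?G ?M ?act \<cong> ?Z2 Mod braided_B2 X \<sigma> A"
    by (simp only: gen_restrict_B1[OF assms(2)])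
  then have "group_H1 ?G ?M ?act \<cong> braided_H2 X \<sigma> A"
    by (simp only: group_H1_def braided_H2_def)
  \<comment> \<open>Restriction runs from group cohomology to braided cohomology, so the isomorphism
    is inverted.\<close>
  then show ?thesis
    by (rule group.iso_sym[OF comm_group.axioms(2)[OF F.comm_group_H1]])
qed

end
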